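(* Let $\mathbb{F}$ be an algebraically closed field with $\mathrm{Char}(\mathbb{F})\neq 2$ and let $L=\mathfrak{sl}_2(\mathbb{F})$. Fix $p\in\mathbb{F}$ with $p\neq 0$ and $p\neq 1$. Let $\mathcal{L}$ be the Lie algebra over $\mathbb{F}$ defined by generators $u,v$ and relations $$[u,[u,v]]=4(2p-1)u+4v,\qquad [v,[v,u]]=4(2p-1)v+4u.$$ Then $\mathcal{L}$ is isomorphic to $L$. Moreover each of $u,v$ is normalized semisimple, and $p$ is the corresponding parameter for the pair $u,v$.
   Context: $L=\mathfrak{sl}_2(\mathbb{F})$ is the Lie algebra of trace-zero $2\times 2$ matrices over $\mathbb{F}$ with bracket $[x,y]=xy-yx$. The bilinear form $\langle x,y\rangle$ on $L$ is $\frac18$ times the Killing form; equivalently $\langle x,y\rangle=\mathrm{tr}(xy)/2$. Write $\|x\|^2=\langle x,x\rangle$. An element $x\in L$ is semisimple if $\mathrm{ad}\,x:L\to L$ is diagonalizable; a semisimple $x$ is normalized if $\|x\|^2=1$. For a pair $a,a^*$ of normalized semisimple elements, the corresponding parameter is the scalar $p\in\mathbb{F}$ with $\langle a,a^*\rangle=1-2p$. These notions are applied to $\mathcal{L}$ through an isomorphism $\mathcal{L}\cong L$ (they are invariant under Lie algebra isomorphism; on $\mathcal{L}$, $\langle\,,\rangle$ is $\frac18$ times its Killing form). *)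

theory Defs
  imports "Jordan_Normal_Form.VS_Connect"
begin

text \<open>The record extends the one of modules. The ring product and the unit that a module record
  inherits from HOL-Algebra are not used by the module axioms and carry no information here.\<close>

record ('k, 'a) lie_alg = "('k, 'a) module" +
  brk :: "'a \<Rightarrow> 'a \<Rightarrow> 'a"

locale lie_algebra = vectorspace "class_ring :: 'k::field ring" L
  for L :: "('k::field, 'a, 'm) lie_alg_scheme" (structure) +
  assumes brk_closed: "\<lbrakk>x \<in> carrier L; y \<in> carrier L\<rbrakk> \<Longrightarrow> brk L x y \<in> carrier L"
    and brk_add_left: "\<lbrakk>x \<in> carrier L; y \<in> carrier L; z \<in> carrier L\<rbrakk> \<Longrightarrow>
      brk L (x \<oplus> y) z = brk L x z \<oplus> brk L y z"
    and brk_add_right: "\<lbrakk>x \<in> carrier L; y \<in> carrier L; z \<in> carrier L\<rbrakk> \<Longrightarrow>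
      brk L x (y \<oplus> z) = brk L x y \<oplus> brk L x z"
    and brk_smult_left: "\<lbrakk>x \<in> carrier L; y \<in> carrier L\<rbrakk> \<Longrightarrow>
      brk L (c \<odot>\<^bsub>L\<^esub> x) y = c \<odot>\<^bsub>L\<^esub> brk L x y"
    and brk_smult_right: "\<lbrakk>x \<in> carrier L; y \<in> carrier L\<rbrakk> \<Longrightarrow>
      brk L x (c \<odot>\<^bsub>L\<^esub> y) = c \<odot>\<^bsub>L\<^esub> brk L x y"
    and brk_self: "x \<in> carrier L \<Longrightarrow> brk L x x = \<zero>"
    and jacobi: "\<lbrakk>x \<in> carrier L; y \<in> carrier L; z \<in> carrier L\<rbrakk> \<Longrightarrow>
      brk L x (brk L y z) \<oplus> brk L y (brk L z x) \<oplus> brk L z (brk L x y) = \<zero>"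

definition lie_hom ::
  "('k::field, 'a, 'm) lie_alg_scheme \<Rightarrow> ('k, 'b, 'n) lie_alg_scheme \<Rightarrow> ('a \<Rightarrow> 'b) set" where
  "lie_hom L M = {f \<in> LinearCombinations.module_hom class_ring L M.
     \<forall>x\<in>carrier L. \<forall>y\<in>carrier L. f (brk L x y) = brk M (f x) (f y)}"

definition lie_iso ::
  "('k::field, 'a, 'm) lie_alg_scheme \<Rightarrow> ('k, 'b, 'n) lie_alg_scheme \<Rightarrow> ('a \<Rightarrow> 'b) set" where
  "lie_iso L M = {f \<in> lie_hom L M. bij_betw f (carrier L) (carrier M)}"

definition lie_isomorphic ::
  "('k::field, 'a, 'm) lie_alg_scheme \<Rightarrow> ('k, 'b, 'n) lie_alg_scheme \<Rightarrow> bool" where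
  "lie_isomorphic L M \<longleftrightarrow> lie_iso L M \<noteq> {}"

text \<open>\<open>coord V B v b\<close> is the coefficient of \<open>b\<close> in the expansion of \<open>v\<close> in the finite
  basis \<open>B\<close>; the choice of \<open>a\<close> is unique on \<open>B\<close>.\<close>

definition coord :: "('k::field, 'a, 'm) module_scheme \<Rightarrow> 'a set \<Rightarrow> 'a \<Rightarrow> 'a \<Rightarrow> 'k" where
  "coord V B v = (SOME a. module.lincomb V a B = v)"

text \<open>The trace is independent of the chosen basis. It is meaningful for finite-dimensional
  \<open>V\<close> only.\<close>

definition op_trace :: "('k::field, 'a, 'm) module_scheme \<Rightarrow> ('a \<Rightarrow> 'a) \<Rightarrow> 'k" where
  "op_trace V T =
     (let B = (SOME B. finite B \<and> vectorspace.basis class_ring V B)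
      in \<Sum>b\<in>B. coord V B (T b) b)"

definition diagonalizable_op :: "('k::field, 'a, 'm) module_scheme \<Rightarrow> ('a \<Rightarrow> 'a) \<Rightarrow> bool" where
  "diagonalizable_op V T \<longleftrightarrow>
     (\<exists>B. vectorspace.basis class_ring V B \<and> (\<forall>b\<in>B. \<exists>c. T b = c \<odot>\<^bsub>V\<^esub> b))"

definition ad :: "('k::field, 'a, 'm) lie_alg_scheme \<Rightarrow> 'a \<Rightarrow> 'a \<Rightarrow> 'a" where
  "ad L x y = brk L x y"

definition killing_form :: "('k::field, 'a, 'm) lie_alg_scheme \<Rightarrow> 'a \<Rightarrow> 'a \<Rightarrow> 'k" where
  "killing_form L x y = op_trace L (ad L x \<circ> ad L y)"

text \<open>On \<open>sl 2\<close> this is \<open>\<langle>x, y\<rangle> = tr (x y) / 2\<close>. The characteristic is meant to be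
  different from 2.\<close>

definition lie_form :: "('k::field, 'a, 'm) lie_alg_scheme \<Rightarrow> 'a \<Rightarrow> 'a \<Rightarrow> 'k" where
  "lie_form L x y = killing_form L x y / 8"

definition semisimple_elt :: "('k::field, 'a, 'm) lie_alg_scheme \<Rightarrow> 'a \<Rightarrow> bool" where
  "semisimple_elt L x \<longleftrightarrow> x \<in> carrier L \<and> diagonalizable_op L (ad L x)"

definition normalized_semisimple :: "('k::field, 'a, 'm) lie_alg_scheme \<Rightarrow> 'a \<Rightarrow> bool" where
  "normalized_semisimple L x \<longleftrightarrow> semisimple_elt L x \<and> lie_form L x x = 1"

text \<open>\<open>p\<close> is the parameter of the pair \<open>a\<close>, \<open>b\<close>; it is unique if the characteristic is not 2.\<close>

definition corresponding_parameter ::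
  "('k::field, 'a, 'm) lie_alg_scheme \<Rightarrow> 'a \<Rightarrow> 'a \<Rightarrow> 'k \<Rightarrow> bool" where
  "corresponding_parameter L a b p \<longleftrightarrow>
     normalized_semisimple L a \<and> normalized_semisimple L b \<and> lie_form L a b = 1 - 2 * p"

definition mat_trace :: "'k::comm_ring_1 mat \<Rightarrow> 'k" where
  "mat_trace A = (\<Sum>i<dim_row A. A $$ (i, i))"

definition sl :: "nat \<Rightarrow> ('k::field, 'k mat) lie_alg" where
  "sl n = \<lparr>carrier = {A \<in> carrier_mat n n. mat_trace A = 0},
     mult = undefined, one = undefined,
     zero = 0\<^sub>m n n, add = (+), smult = (\<cdot>\<^sub>m), brk = (\<lambda>A B. A * B - B * A)\<rparr>"

lemma lie_algebra_sl: "lie_algebra (sl n :: ('k::field, 'k mat) lie_alg)"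
proof -
  let ?L = "sl n :: ('k, 'k mat) lie_alg"
  have tr_add: "mat_trace (A + B) = mat_trace A + mat_trace B"
    if "A \<in> carrier_mat n n" "B \<in> carrier_mat n n" for A B :: "'k mat"
    using that by (auto simp: mat_trace_def sum.distrib)
  have tr_minus: "mat_trace (A - B) = mat_trace A - mat_trace B"
    if "A \<in> carrier_mat n n" "B \<in> carrier_mat n n" for A B :: "'k mat"
    using that by (auto simp: mat_trace_def sum_subtractf)
  have tr_smult: "mat_trace (c \<cdot>\<^sub>m A) = c * mat_trace A"
    if "A \<in> carrier_mat n n" for A :: "'k mat" and c
    using that by (auto simp: mat_trace_def sum_distrib_left)
  have tr_comm: "mat_trace (A * B) = mat_trace (B * A)"
    if "A \<in> carrier_mat n n" "B \<in> carrier_mat n n" for A B :: "'k mat"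
  proof -
    have "mat_trace (A * B) = (\<Sum>i<n. \<Sum>j<n. A $$ (i, j) * B $$ (j, i))"
      using that by (auto simp: mat_trace_def scalar_prod_def atLeast0LessThan)
    also have "\<dots> = (\<Sum>j<n. \<Sum>i<n. B $$ (j, i) * A $$ (i, j))"
      by (subst sum.swap) (simp add: mult.commute)
    also have "\<dots> = mat_trace (B * A)"
      using that by (auto simp: mat_trace_def scalar_prod_def atLeast0LessThan)
    finally show ?thesis .
  qed
  have tr_zero: "mat_trace (0\<^sub>m n n :: 'k mat) = 0"
    by (simp add: mat_trace_def)
  have "abelian_group ?L"
  proof (rule abelian_groupI)
    fix x assume x: "x \<in> carrier ?L"
    then show "\<exists>y\<in>carrier ?L. y \<oplus>\<^bsub>?L\<^esub> x = \<zero>\<^bsub>?L\<^esub>"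
      by (intro bexI[of _ "(- 1) \<cdot>\<^sub>m x"]) (auto simp: sl_def tr_smult)
  qed (auto simp: sl_def tr_add tr_zero)
  moreover have "cring (class_ring :: 'k ring)"
    using class_field by (rule fieldE(1))
  ultimately have "module class_ring ?L"
    by (intro moduleI) (auto simp: sl_def tr_smult add_smult_distrib_left_mat
        add_smult_distrib_right_mat mult_smult_assoc_mat)
  then have "vectorspace class_ring ?L"
    by (rule vectorspace.intro[OF _ class_field])
  then show ?thesis
  proof (rule lie_algebra.intro, unfold_locales)
    fix x y z :: "'k mat" and c
    show "brk ?L x y \<in> carrier ?L" if "x \<in> carrier ?L" "y \<in> carrier ?L"
      using that by (auto simp: sl_def tr_minus tr_comm)
    show "brk ?L x x = \<zero>\<^bsub>?L\<^esub>" if "x \<in> carrier ?L"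
      using that by (auto simp: sl_def)
    show "brk ?L (c \<odot>\<^bsub>?L\<^esub> x) y = c \<odot>\<^bsub>?L\<^esub> brk ?L x y"
      "brk ?L x (c \<odot>\<^bsub>?L\<^esub> y) = c \<odot>\<^bsub>?L\<^esub> brk ?L x y"
      if "x \<in> carrier ?L" "y \<in> carrier ?L"
      using that by (auto simp: sl_def mult_smult_assoc_mat mult_smult_distrib algebra_simps
          intro!: eq_matI)
    assume "x \<in> carrier ?L" "y \<in> carrier ?L" "z \<in> carrier ?L"
    then have c: "x \<in> carrier_mat n n" "y \<in> carrier_mat n n" "z \<in> carrier_mat n n"
      by (auto simp: sl_def)
    note [simp] = add_mult_distrib_mat[of _ n n _ _ n] mult_add_distrib_mat[of _ n n _ n]
      minus_mult_distrib_mat[of _ n n _ _ n] mult_minus_distrib_mat[of _ n n _ n]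
    show "brk ?L (x \<oplus>\<^bsub>?L\<^esub> y) z = brk ?L x z \<oplus>\<^bsub>?L\<^esub> brk ?L y z"
      "brk ?L x (y \<oplus>\<^bsub>?L\<^esub> z) = brk ?L x y \<oplus>\<^bsub>?L\<^esub> brk ?L x z"
      using c by (auto simp: sl_def simp del: index_mult_mat(1) intro!: eq_matI)
    show "brk ?L x (brk ?L y z) \<oplus>\<^bsub>?L\<^esub> brk ?L y (brk ?L z x) \<oplus>\<^bsub>?L\<^esub> brk ?L z (brk ?L x y) = \<zero>\<^bsub>?L\<^esub>"
      using c by (auto simp: sl_def assoc_mult_mat[of _ n n _ n _ n] simp del: index_mult_mat(1)
          intro!: eq_matI)
  qed
qed

text \<open>Formal Lie expressions in generators of type \<open>'g\<close>. The Lie algebra with relations \<open>R\<close>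
  is their quotient by the least congruence that contains \<open>R\<close> and all instances of the axioms of
  a Lie algebra over \<open>'k\<close>.\<close>

datatype ('k, 'g) lie_term =
    Gen 'g
  | Zero
  | Add "('k, 'g) lie_term" "('k, 'g) lie_term"
  | Smult 'k "('k, 'g) lie_term"
  | Brk "('k, 'g) lie_term" "('k, 'g) lie_term"

type_synonym ('k, 'g) lie_rels = "(('k, 'g) lie_term \<times> ('k, 'g) lie_term) set"

inductive lie_eq ::
  "('k::field, 'g) lie_rels \<Rightarrow> ('k, 'g) lie_term \<Rightarrow> ('k, 'g) lie_term \<Rightarrow> bool"
  for R :: "('k, 'g) lie_rels" where
  rel: "(s, t) \<in> R \<Longrightarrow> lie_eq R s t"
| refl: "lie_eq R s s"
| sym: "lie_eq R s t \<Longrightarrow> lie_eq R t s"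
| trans: "lie_eq R s t \<Longrightarrow> lie_eq R t r \<Longrightarrow> lie_eq R s r"
| cong_add: "lie_eq R s s' \<Longrightarrow> lie_eq R t t' \<Longrightarrow> lie_eq R (Add s t) (Add s' t')"
| cong_smult: "lie_eq R s s' \<Longrightarrow> lie_eq R (Smult c s) (Smult c s')"
| cong_brk: "lie_eq R s s' \<Longrightarrow> lie_eq R t t' \<Longrightarrow> lie_eq R (Brk s t) (Brk s' t')"
| add_assoc: "lie_eq R (Add (Add s t) r) (Add s (Add t r))"
| add_comm: "lie_eq R (Add s t) (Add t s)"
| add_zero: "lie_eq R (Add Zero s) s"
| add_neg: "lie_eq R (Add (Smult (- 1) s) s) Zero"
| smult_add: "lie_eq R (Smult c (Add s t)) (Add (Smult c s) (Smult c t))"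
| add_smult: "lie_eq R (Smult (c + d) s) (Add (Smult c s) (Smult d s))"
| smult_smult: "lie_eq R (Smult (c * d) s) (Smult c (Smult d s))"
| smult_one: "lie_eq R (Smult 1 s) s"
| brk_add_left: "lie_eq R (Brk (Add s t) r) (Add (Brk s r) (Brk t r))"
| brk_add_right: "lie_eq R (Brk s (Add t r)) (Add (Brk s t) (Brk s r))"
| brk_smult_left: "lie_eq R (Brk (Smult c s) t) (Smult c (Brk s t))"
| brk_smult_right: "lie_eq R (Brk s (Smult c t)) (Smult c (Brk s t))"
| brk_self: "lie_eq R (Brk s s) Zero"
| jacobi: "lie_eq R (Add (Add (Brk s (Brk t r)) (Brk t (Brk r s))) (Brk r (Brk s t))) Zero"

definition lie_class ::
  "('k::field, 'g) lie_rels \<Rightarrow> ('k, 'g) lie_term \<Rightarrow> ('k, 'g) lie_term set" where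
  "lie_class R s = {t. lie_eq R s t}"

definition lie_presented ::
  "('k::field, 'g) lie_rels \<Rightarrow> ('k, ('k, 'g) lie_term set) lie_alg" where
  "lie_presented R = \<lparr>carrier = range (lie_class R),
     mult = undefined, one = undefined,
     zero = lie_class R Zero,
     add = (\<lambda>X Y. \<Union>s\<in>X. \<Union>t\<in>Y. lie_class R (Add s t)),
     smult = (\<lambda>c X. \<Union>s\<in>X. lie_class R (Smult c s)),
     brk = (\<lambda>X Y. \<Union>s\<in>X. \<Union>t\<in>Y. lie_class R (Brk s t))\<rparr>"

lemma lie_class_eq_iff: "lie_class R s = lie_class R t \<longleftrightarrow> lie_eq R s t"
  unfolding lie_class_def by (blast intro: lie_eq.refl lie_eq.sym lie_eq.trans)

lemma lie_presented_simps:
  "carrier (lie_presented R) = range (lie_class R)"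
  "\<zero>\<^bsub>lie_presented R\<^esub> = lie_class R Zero"
  "lie_class R s \<oplus>\<^bsub>lie_presented R\<^esub> lie_class R t = lie_class R (Add s t)"
  "c \<odot>\<^bsub>lie_presented R\<^esub> lie_class R s = lie_class R (Smult c s)"
  "brk (lie_presented R) (lie_class R s) (lie_class R t) = lie_class R (Brk s t)"
proof -
  have union: "(\<Union>x\<in>lie_class R s. lie_class R (f x)) = lie_class R (f s)"
    if "\<And>x. lie_eq R s x \<Longrightarrow> lie_eq R (f s) (f x)" for f s
    using that unfolding lie_class_def by (blast intro: lie_eq.refl lie_eq.sym lie_eq.trans)
  show "carrier (lie_presented R) = range (lie_class R)" "\<zero>\<^bsub>lie_presented R\<^esub> = lie_class R Zero"
    by (simp_all add: lie_presented_def)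
  show "c \<odot>\<^bsub>lie_presented R\<^esub> lie_class R s = lie_class R (Smult c s)"
    by (simp add: lie_presented_def union lie_eq.cong_smult)
  show "lie_class R s \<oplus>\<^bsub>lie_presented R\<^esub> lie_class R t = lie_class R (Add s t)"
    "brk (lie_presented R) (lie_class R s) (lie_class R t) = lie_class R (Brk s t)"
    by (simp_all add: lie_presented_def union lie_eq.cong_add lie_eq.cong_brk lie_eq.refl)
qed

lemma lie_algebra_presented: "lie_algebra (lie_presented R)"
proof -
  let ?L = "lie_presented R"
  have "abelian_group ?L"
  proof (rule abelian_groupI)
    fix x assume "x \<in> carrier ?L"
    then obtain s where "x = lie_class R s" by (auto simp: lie_presented_simps)
    then show "\<exists>y\<in>carrier ?L. y \<oplus>\<^bsub>?L\<^esub> x = \<zero>\<^bsub>?L\<^esub>"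
      by (intro bexI[of _ "lie_class R (Smult (- 1) s)"])
        (auto simp: lie_presented_simps lie_class_eq_iff lie_eq.add_neg)
  qed (auto simp: lie_presented_simps lie_class_eq_iff lie_eq.add_assoc lie_eq.add_comm
      lie_eq.add_zero rangeI del: equalityI)
  moreover have "cring (class_ring :: 'a ring)"
    using class_field by (rule fieldE(1))
  ultimately have "module class_ring ?L"
    by (intro moduleI)
      (auto simp: lie_presented_simps lie_class_eq_iff lie_eq.smult_add lie_eq.add_smult
        lie_eq.smult_smult lie_eq.smult_one rangeI del: equalityI)
  then have "vectorspace class_ring ?L"
    by (rule vectorspace.intro[OF _ class_field])
  then show ?thesis
    by (rule lie_algebra.intro, unfold_locales)
      (auto simp: lie_presented_simps lie_class_eq_iff lie_eq.brk_add_left lie_eq.brk_add_right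
        lie_eq.brk_smult_left lie_eq.brk_smult_right lie_eq.brk_self lie_eq.jacobi rangeI
        del: equalityI)
qed

primrec lie_eval :: "('k::field, 'a, 'm) lie_alg_scheme \<Rightarrow> ('g \<Rightarrow> 'a) \<Rightarrow> ('k, 'g) lie_term \<Rightarrow> 'a" where
  "lie_eval L f (Gen g) = f g"
| "lie_eval L f Zero = \<zero>\<^bsub>L\<^esub>"
| "lie_eval L f (Add s t) = lie_eval L f s \<oplus>\<^bsub>L\<^esub> lie_eval L f t"
| "lie_eval L f (Smult c s) = c \<odot>\<^bsub>L\<^esub> lie_eval L f s"
| "lie_eval L f (Brk s t) = brk L (lie_eval L f s) (lie_eval L f t)"

context lie_algebra
begin

lemma smult_closed': "x \<in> carrier L \<Longrightarrow> c \<odot>\<^bsub>L\<^esub> x \<in> carrier L"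
  using smult_closed by simp

lemma smult_one': "x \<in> carrier L \<Longrightarrow> 1 \<odot>\<^bsub>L\<^esub> x = x"
  using smult_one by simp

lemma lie_eval_closed:
  assumes "range f \<subseteq> carrier L"
  shows "lie_eval L f t \<in> carrier L"
  using assms by (induction t) (auto simp: brk_closed smult_closed')

lemma lie_eval_eq:
  assumes f: "range f \<subseteq> carrier L"
    and R: "\<And>s t. (s, t) \<in> R \<Longrightarrow> lie_eval L f s = lie_eval L f t"
    and "lie_eq R s t"
  shows "lie_eval L f s = lie_eval L f t"
  using assms(3)
proof induction
  case (add_neg s)
  have c: "lie_eval L f s \<in> carrier L" by (rule lie_eval_closed[OF f])
  have "(- 1 + 1) \<odot>\<^bsub>L\<^esub> lie_eval L f s = - 1 \<odot>\<^bsub>L\<^esub> lie_eval L f s \<oplus> 1 \<odot>\<^bsub>L\<^esub> lie_eval L f s"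
    using smult_l_distr[of "- 1" 1 "lie_eval L f s"] c by simp
  moreover have "1 \<odot>\<^bsub>L\<^esub> lie_eval L f s = lie_eval L f s" "0 \<odot>\<^bsub>L\<^esub> lie_eval L f s = \<zero>"
    using smult_one[OF c] lmult_0[OF c] by simp_all
  ultimately show ?case by simp
next
  case (smult_add c s t) then show ?case
    using smult_r_distr[of c "lie_eval L f s" "lie_eval L f t"] lie_eval_closed[OF f] by simp
next
  case (add_smult c d s) then show ?case
    using smult_l_distr[of c d "lie_eval L f s"] lie_eval_closed[OF f] by simp
next
  case (smult_smult c d s) then show ?case
    using smult_assoc1[of c d "lie_eval L f s"] lie_eval_closed[OF f] by simp
next
  case (smult_one s) then show ?case
    using smult_one'[of "lie_eval L f s"] lie_eval_closed[OF f] by simp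
qed (simp_all add: R lie_eval_closed[OF f] M.a_ac brk_add_left brk_add_right
      brk_smult_left brk_smult_right brk_self jacobi)

text \<open>The universal property: a map from the generators to \<open>L\<close> that respects the relations
  extends uniquely to a homomorphism.\<close>

lemma lie_presented_universal:
  assumes f: "range f \<subseteq> carrier L"
    and R: "\<And>s t. (s, t) \<in> R \<Longrightarrow> lie_eval L f s = lie_eval L f t"
  shows "\<exists>h \<in> lie_hom (lie_presented R) L.
    (\<forall>g. h (lie_class R (Gen g)) = f g) \<and>
    (\<forall>h' \<in> lie_hom (lie_presented R) L. (\<forall>g. h' (lie_class R (Gen g)) = f g) \<longrightarrow>
      (\<forall>x \<in> carrier (lie_presented R). h' x = h x))"
proof -
  define h where "h X = lie_eval L f (SOME t. t \<in> X)" for X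
  have h: "h (lie_class R t) = lie_eval L f t" for t
  proof -
    have "t \<in> lie_class R t" by (simp add: lie_class_def lie_eq.refl)
    then have "(SOME s. s \<in> lie_class R t) \<in> lie_class R t" by (rule someI)
    then show ?thesis
      using lie_eval_eq[OF f R, of R t] by (simp add: h_def lie_class_def)
  qed
  have "h \<in> lie_hom (lie_presented R) L"
    by (auto simp: lie_hom_def LinearCombinations.module_hom_def lie_presented_simps h lie_eval_closed[OF f])
  moreover have "h' (lie_class R t) = h (lie_class R t)"
    if h': "h' \<in> lie_hom (lie_presented R) L" and g: "\<And>g. h' (lie_class R (Gen g)) = f g" for h' t
  proof (induction t)
    case Zero
    have hm: "h' \<in> LinearCombinations.module_hom class_ring (lie_presented R) L"
      using h' by (simp add: lie_hom_def)
    interpret P: lie_algebra "lie_presented R" by (rule lie_algebra_presented)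
    interpret mod_hom class_ring "lie_presented R" L h'
      by unfold_locales (rule hm)
    show ?case using f0_is_0 by (simp add: h lie_presented_simps)
  next
    case (Gen x) then show ?case by (simp add: g h)
  next
    case (Add s t)
    have "h' (lie_class R s \<oplus>\<^bsub>lie_presented R\<^esub> lie_class R t) = h' (lie_class R s) \<oplus> h' (lie_class R t)"
      using h' by (auto simp: lie_hom_def LinearCombinations.module_hom_def lie_presented_simps(1))
    with Add show ?case by (simp add: h lie_presented_simps)
  next
    case (Smult c s)
    have "h' (c \<odot>\<^bsub>lie_presented R\<^esub> lie_class R s) = c \<odot>\<^bsub>L\<^esub> h' (lie_class R s)"
      using h' by (auto simp: lie_hom_def LinearCombinations.module_hom_def lie_presented_simps(1))
    with Smult show ?case by (simp add: h lie_presented_simps)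
  next
    case (Brk s t)
    have "h' (brk (lie_presented R) (lie_class R s) (lie_class R t)) =
        brk L (h' (lie_class R s)) (h' (lie_class R t))"
      using h' by (auto simp: lie_hom_def lie_presented_simps(1))
    with Brk show ?case by (simp add: h lie_presented_simps)
  qed
  ultimately show ?thesis
    by (intro bexI[of _ h]) (auto simp: h lie_presented_simps(1))
qed

end

datatype gens = gen_u | gen_v

definition uv_rels :: "'k::field \<Rightarrow> ('k, gens) lie_rels" where
  "uv_rels p = (let u = Gen gen_u; v = Gen gen_v in
     {(Brk u (Brk u v), Add (Smult (4 * (2 * p - 1)) u) (Smult 4 v)),
      (Brk v (Brk v u), Add (Smult (4 * (2 * p - 1)) v) (Smult 4 u))})"

definition uv_lie :: "'k::field \<Rightarrow> ('k, ('k, gens) lie_term set) lie_alg" where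
  "uv_lie p = lie_presented (uv_rels p)"

definition uv_u :: "'k::field \<Rightarrow> ('k, gens) lie_term set" where
  "uv_u p = lie_class (uv_rels p) (Gen gen_u)"

definition uv_v :: "'k::field \<Rightarrow> ('k, gens) lie_term set" where
  "uv_v p = lie_class (uv_rels p) (Gen gen_v)"

end

theory Submission
  imports Defs
begin

text \<open>The relations express \<open>[u, [u, v]]\<close> and \<open>[v, [v, u]]\<close> in \<open>u, v\<close>, so \<open>u\<close>, \<open>v\<close> and
  \<open>w = [u, v]\<close> span the presented algebra: their span is closed under the bracket. The universal
  property gives a homomorphism to \<open>sl 2\<close> under which the images of \<open>u, v, w\<close> form a basis as
  \<open>p \<noteq> 0, 1\<close>. Hence \<open>u, v, w\<close> is a basis and the homomorphism is an isomorphism. The Killing form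
  and the eigenvectors of \<open>ad u\<close> are then read off in this basis, and exchanging \<open>u\<close> and \<open>v\<close>
  yields the statements about \<open>v\<close>.\<close>

section \<open>Scalars, coordinates and the trace of an operator\<close>

lemma four_eight_nonzero:
  assumes "(2::'k::field) \<noteq> 0"
  shows "(4::'k) \<noteq> 0" "(8::'k) \<noteq> 0"
proof -
  have "(4::'k) = 2 * 2" "(8::'k) = 2 * 4"
    by simp_all
  then show "(4::'k) \<noteq> 0" "(8::'k) \<noteq> 0"
    using assms by (metis mult_eq_0_iff)+
qed

text \<open>The scalars of \<open>class_ring\<close> are the whole type \<open>'k\<close>, so the
  module laws can be restated with \<open>+\<close>, \<open>*\<close>, \<open>0\<close>,
  \<open>1\<close> of the type; all coefficient computations below run in this form.\<close>

locale type_vectorspace = vectorspace "class_ring :: 'k::field ring" V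
  for V :: "('k::field, 'a, 'm) module_scheme" (structure)

sublocale lie_algebra \<subseteq> type_vectorspace L ..

context type_vectorspace
begin

lemma smult_in [simp]: "x \<in> carrier V \<Longrightarrow> c \<odot>\<^bsub>V\<^esub> x \<in> carrier V"
  using smult_closed by simp

lemma smult_add_left: "x \<in> carrier V \<Longrightarrow> (c + d) \<odot>\<^bsub>V\<^esub> x = c \<odot>\<^bsub>V\<^esub> x \<oplus> d \<odot>\<^bsub>V\<^esub> x"
  using smult_l_distr[of c d x] by simp

lemma smult_add_right: "x \<in> carrier V \<Longrightarrow> y \<in> carrier V \<Longrightarrow>
    c \<odot>\<^bsub>V\<^esub> (x \<oplus> y) = c \<odot>\<^bsub>V\<^esub> x \<oplus> c \<odot>\<^bsub>V\<^esub> y"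
  using smult_r_distr[of c x y] by simp

lemma smult_mult: "x \<in> carrier V \<Longrightarrow> (c * d) \<odot>\<^bsub>V\<^esub> x = c \<odot>\<^bsub>V\<^esub> (d \<odot>\<^bsub>V\<^esub> x)"
  using smult_assoc1[of c d x] by simp

lemma smult_1 [simp]: "x \<in> carrier V \<Longrightarrow> 1 \<odot>\<^bsub>V\<^esub> x = x"
  using smult_one by simp

lemma smult_0 [simp]: "x \<in> carrier V \<Longrightarrow> 0 \<odot>\<^bsub>V\<^esub> x = \<zero>"
  using lmult_0 by simp

text \<open>Meant for the functionals that send a vector, or its image under an operator, to one
  fixed coordinate. In the base case \<open>g\<close> vanishes at zero because zero is
  \<open>0\<close> times itself.\<close>

lemma linear_functional_lincomb:
  fixes g :: "'a \<Rightarrow> 'k"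
  assumes add: "\<And>x y. x \<in> carrier V \<Longrightarrow> y \<in> carrier V \<Longrightarrow> g (x \<oplus> y) = g x + g y"
    and smult: "\<And>c x. x \<in> carrier V \<Longrightarrow> g (c \<odot>\<^bsub>V\<^esub> x) = c * g x"
    and "finite A" "A \<subseteq> carrier V"
  shows "g (lincomb a A) = (\<Sum>v\<in>A. a v * g v)"
  using assms(3,4)
proof (induction A rule: finite_induct)
  case empty
  show ?case
    using smult[of \<zero> 0] by (simp add: lincomb_def)
next
  case (insert x A)
  have "lincomb a (insert x A) = a x \<odot>\<^bsub>V\<^esub> x \<oplus> lincomb a A"
    unfolding lincomb_def using insert by (subst M.finsum_insert) (auto simp: subset_iff)
  moreover have "lincomb a A \<in> carrier V"
    using insert by (intro lincomb_closed) auto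
  ultimately show ?case
    using insert by (simp add: add smult)
qed

context
  fixes B
  assumes fin: "finite B" and bas: "basis B"
begin

lemma lincomb_coord:
  assumes "v \<in> carrier V"
  shows "lincomb (coord V B v) B = v"
proof -
  have "\<exists>a. lincomb a B = v"
    using bas assms fin basis_criterion[of B] unfolding basis_def by blast
  then show ?thesis
    unfolding coord_def by (rule someI_ex)
qed

text \<open>Coefficients are unique only on \<open>B\<close>: the criterion for a basis speaks of
  functions that are \<open>undefined\<close> elsewhere, while \<open>coord\<close> is an arbitrary
  choice there. Hence both functions are restricted to \<open>B\<close> before they are
  compared.\<close>

lemma coord_eqI:
  assumes "lincomb a B = v" and b: "b \<in> B"
  shows "coord V B v b = a b"
proof -
  have B: "B \<subseteq> carrier V"
    using bas by (simp add: basis_def)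
  then have v: "v \<in> carrier V"
    using assms(1) by auto
  have r: "lincomb (restrict f B) B = lincomb f B" for f
    using B by (intro lincomb_cong) auto
  let ?P = "\<lambda>f. f \<in> B \<rightarrow>\<^sub>E carrier class_ring \<and> lincomb f B = v"
  have "\<exists>!f. ?P f"
    using bas basis_criterion[OF fin B] v by blast
  moreover have "?P (restrict (coord V B v) B)" "?P (restrict a B)"
    using lincomb_coord[OF v] assms(1) by (auto simp: r)
  ultimately have "restrict (coord V B v) B = restrict a B"
    by blast
  then have "restrict (coord V B v) B b = restrict a B b"
    by simp
  then show ?thesis
    using b by simp
qed

lemma coord_add:
  assumes "x \<in> carrier V" "y \<in> carrier V" "b \<in> B"
  shows "coord V B (x \<oplus> y) b = coord V B x b + coord V B y b"
proof (rule coord_eqI[OF _ assms(3)])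
  have B: "B \<subseteq> carrier V"
    using bas by (simp add: basis_def)
  have "lincomb (\<lambda>b. coord V B x b + coord V B y b) B
      = lincomb (coord V B x) B \<oplus> lincomb (coord V B y) B"
    using lincomb_sum[OF fin B, of "coord V B x" "coord V B y"] by simp
  then show "lincomb (\<lambda>b. coord V B x b + coord V B y b) B = x \<oplus> y"
    using assms by (simp add: lincomb_coord)
qed

lemma coord_smult:
  assumes "x \<in> carrier V" "b \<in> B"
  shows "coord V B (c \<odot>\<^bsub>V\<^esub> x) b = c * coord V B x b"
proof (rule coord_eqI[OF _ assms(2)])
  have B: "B \<subseteq> carrier V"
    using bas by (simp add: basis_def)
  have "lincomb (\<lambda>b. c * coord V B x b) B = c \<odot>\<^bsub>V\<^esub> lincomb (coord V B x) B"
    using lincomb_smult[OF B, of "coord V B x" c] by simp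
  then show "lincomb (\<lambda>b. c * coord V B x b) B = c \<odot>\<^bsub>V\<^esub> x"
    using assms by (simp add: lincomb_coord)
qed

end

text \<open>Both sides equal the sum over \<open>b\<close> and \<open>c\<close> of
  \<open>coord V C (T b) c * coord V B c b\<close>. For fixed \<open>b\<close>, expand
  \<open>T b\<close> in \<open>C\<close> and take the coordinate at \<open>b\<close>; for fixed
  \<open>c\<close>, expand \<open>c\<close> in \<open>B\<close> and apply the functional that maps
  \<open>x\<close> to the coordinate of \<open>T x\<close> at \<open>c\<close>.\<close>

lemma trace_basis_independent:
  assumes T: "T \<in> LinearCombinations.module_hom class_ring V V"
    and B: "finite B" "basis B" and C: "finite C" "basis C"
  shows "(\<Sum>b\<in>B. coord V B (T b) b) = (\<Sum>c\<in>C. coord V C (T c) c)"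
proof -
  have BV: "B \<subseteq> carrier V" and CV: "C \<subseteq> carrier V"
    using B C by (simp_all add: basis_def)
  have T_in: "T x \<in> carrier V" if "x \<in> carrier V" for x
    using T that by (auto simp: LinearCombinations.module_hom_def)
  have T_add: "T (x \<oplus> y) = T x \<oplus> T y" if "x \<in> carrier V" "y \<in> carrier V" for x y
    using T that by (auto simp: LinearCombinations.module_hom_def)
  have T_smult: "T (k \<odot>\<^bsub>V\<^esub> x) = k \<odot>\<^bsub>V\<^esub> T x" if "x \<in> carrier V" for x k
    using T that by (auto simp: LinearCombinations.module_hom_def)
  have "coord V B (T b) b = (\<Sum>c\<in>C. coord V C (T b) c * coord V B c b)" if b: "b \<in> B" for b
    using linear_functional_lincomb[of "\<lambda>x. coord V B x b" C "coord V C (T b)"]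
      coord_add[OF B] coord_smult[OF B] lincomb_coord[OF C, of "T b"] C CV BV T_in b
    by auto
  then have "(\<Sum>b\<in>B. coord V B (T b) b) = (\<Sum>b\<in>B. \<Sum>c\<in>C. coord V C (T b) c * coord V B c b)"
    by simp
  also have "\<dots> = (\<Sum>c\<in>C. \<Sum>b\<in>B. coord V B c b * coord V C (T b) c)"
    by (subst sum.swap) (simp add: mult.commute)
  also have "\<dots> = (\<Sum>c\<in>C. coord V C (T c) c)"
  proof (rule sum.cong[OF HOL.refl])
    fix c assume c: "c \<in> C"
    show "(\<Sum>b\<in>B. coord V B c b * coord V C (T b) c) = coord V C (T c) c"
      using linear_functional_lincomb[of "\<lambda>x. coord V C (T x) c" B "coord V B c"]
        coord_add[OF C] coord_smult[OF C] lincomb_coord[OF B, of c] B BV CV T_in T_add T_smult c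
      by auto
  qed
  finally show ?thesis .
qed

text \<open>Frees the trace from the basis picked by \<open>SOME\<close>, so that it can be computed
  in a convenient one.\<close>

lemma op_trace_eq:
  assumes T: "T \<in> LinearCombinations.module_hom class_ring V V" and B: "finite B" "basis B"
  shows "op_trace V T = (\<Sum>b\<in>B. coord V B (T b) b)"
proof -
  define C where "C = (SOME B. finite B \<and> basis B)"
  have "finite C \<and> basis C"
    unfolding C_def using B by (intro someI[of "\<lambda>B. finite B \<and> basis B"]) simp
  then show ?thesis
    using trace_basis_independent[OF T _ _ B, of C] by (simp add: op_trace_def C_def)
qed

section \<open>Ordered bases of three vectors\<close>

definition comb3 :: "'a \<Rightarrow> 'a \<Rightarrow> 'a \<Rightarrow> 'k \<Rightarrow> 'k \<Rightarrow> 'k \<Rightarrow> 'a" where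
  "comb3 x y z a b c = a \<odot>\<^bsub>V\<^esub> x \<oplus> b \<odot>\<^bsub>V\<^esub> y \<oplus> c \<odot>\<^bsub>V\<^esub> z"

text \<open>An ordered basis phrased through coefficient triples: spanning by induction on terms and
  injectivity of a homomorphism on combinations establish it directly.\<close>

definition frame3 :: "'a \<Rightarrow> 'a \<Rightarrow> 'a \<Rightarrow> bool" where
  "frame3 x y z \<longleftrightarrow> {x, y, z} \<subseteq> carrier V \<and>
     (\<forall>v\<in>carrier V. \<exists>a b c. v = comb3 x y z a b c) \<and>
     (\<forall>a b c a' b' c'. comb3 x y z a b c = comb3 x y z a' b' c' \<longrightarrow> a = a' \<and> b = b' \<and> c = c')"

lemma comb3_unit:
  assumes "x \<in> carrier V" "y \<in> carrier V" "z \<in> carrier V"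
  shows "comb3 x y z 1 0 0 = x" "comb3 x y z 0 1 0 = y" "comb3 x y z 0 0 1 = z"
  using assms by (simp_all add: comb3_def)

lemma comb3_closed [simp]:
  assumes "x \<in> carrier V" "y \<in> carrier V" "z \<in> carrier V"
  shows "comb3 x y z a b c \<in> carrier V"
  using assms by (simp add: comb3_def)

lemma comb3_add:
  assumes "x \<in> carrier V" "y \<in> carrier V" "z \<in> carrier V"
  shows "comb3 x y z a b c \<oplus> comb3 x y z a' b' c' = comb3 x y z (a + a') (b + b') (c + c')"
  using assms by (simp add: comb3_def smult_add_left M.a_ac)

lemma comb3_smult:
  assumes "x \<in> carrier V" "y \<in> carrier V" "z \<in> carrier V"
  shows "k \<odot>\<^bsub>V\<^esub> comb3 x y z a b c = comb3 x y z (k * a) (k * b) (k * c)"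
  using assms by (simp add: comb3_def smult_add_right smult_mult)

text \<open>Equal vectors would have two different unit triples. Distinctness lets sums over the set
  \<open>{x, y, z}\<close> have three terms.\<close>

lemma frame3_distinct:
  assumes "frame3 x y z"
  shows "x \<noteq> y" "x \<noteq> z" "y \<noteq> z"
proof -
  have c: "x \<in> carrier V" "y \<in> carrier V" "z \<in> carrier V"
    and inj: "\<And>a b c a' b' c'. comb3 x y z a b c = comb3 x y z a' b' c' \<Longrightarrow> a = a' \<and> b = b' \<and> c = c'"
    using assms by (auto simp: frame3_def)
  show "x \<noteq> y" "x \<noteq> z" "y \<noteq> z"
    using comb3_unit[OF c] inj[of 1 0 0 0 1 0] inj[of 1 0 0 0 0 1] inj[of 0 1 0 0 0 1] by auto
qed

lemma lincomb_frame3: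
  assumes "frame3 x y z"
  shows "lincomb f {x, y, z} = comb3 x y z (f x) (f y) (f z)"
  using assms frame3_distinct[OF assms]
  by (simp add: frame3_def lincomb_def comb3_def M.finsum_insert M.a_assoc)

lemma frame3_basis:
  assumes F: "frame3 x y z"
  shows "basis {x, y, z}"
proof -
  let ?B = "{x, y, z}"
  have B: "?B \<subseteq> carrier V"
    using F by (simp add: frame3_def)
  note d = frame3_distinct[OF F]
  have "\<exists>!f. f \<in> ?B \<rightarrow>\<^sub>E carrier class_ring \<and> lincomb f ?B = v" if v: "v \<in> carrier V" for v
  proof -
    obtain a b c where abc: "v = comb3 x y z a b c"
      using F v unfolding frame3_def by blast
    show ?thesis
    proof (rule ex1I)
      let ?f = "restrict (\<lambda>t. if t = x then a else if t = y then b else c) ?B"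
      show "?f \<in> ?B \<rightarrow>\<^sub>E carrier class_ring \<and> lincomb ?f ?B = v"
        using d by (auto simp: lincomb_frame3[OF F] abc)
      fix f assume f: "f \<in> ?B \<rightarrow>\<^sub>E carrier class_ring \<and> lincomb f ?B = v"
      then have "f x = a \<and> f y = b \<and> f z = c"
        using F unfolding lincomb_frame3[OF F] abc frame3_def by blast
      \<comment> \<open>The three values determine \<open>f\<close> on the set; outside it,
        membership in the extensional function space fixes the default value, which
        \<open>restrict\<close> also takes.\<close>
      moreover have "f t = undefined" if "t \<notin> ?B" for t
        using f that PiE_arb[of f ?B] by blast
      ultimately show "f = ?f"
        using d by (intro ext) (simp add: restrict_def)
    qed
  qed
  then show ?thesis
    using basis_criterion[OF _ B] by blast
qed

lemma op_trace_frame3: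
  assumes F: "frame3 x y z" and T: "T \<in> LinearCombinations.module_hom class_ring V V"
    and Tx: "T x = comb3 x y z a b c" and Ty: "T y = comb3 x y z a' b' c'"
    and Tz: "T z = comb3 x y z a'' b'' c''"
  shows "op_trace V T = a + b' + c''"
proof -
  let ?B = "{x, y, z}"
  note d = frame3_distinct[OF F]
  have coord: "coord V ?B (comb3 x y z r s t) x = r"
    "coord V ?B (comb3 x y z r s t) y = s"
    "coord V ?B (comb3 x y z r s t) z = t" for r s t
    using coord_eqI[OF _ frame3_basis[OF F],
        of "\<lambda>w. if w = x then r else if w = y then s else t" "comb3 x y z r s t"] d
    by (auto simp: lincomb_frame3[OF F])
  show ?thesis
    using d coord by (simp add: op_trace_eq[OF T _ frame3_basis[OF F]] Tx Ty Tz add.assoc)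
qed

end

section \<open>Adjoint operators and pairs satisfying the two relations\<close>

lemma (in lie_algebra) ad_hom:
  "x \<in> carrier L \<Longrightarrow> ad L x \<in> LinearCombinations.module_hom class_ring L L"
  by (auto simp: LinearCombinations.module_hom_def ad_def brk_closed brk_add_right brk_smult_right)

lemma (in lie_algebra) ad_comp_hom:
  assumes "x \<in> carrier L" "y \<in> carrier L"
  shows "ad L x \<circ> ad L y \<in> LinearCombinations.module_hom class_ring L L"
  using ad_hom[OF assms(1)] ad_hom[OF assms(2)]
  by (auto simp: LinearCombinations.module_hom_def Pi_iff)

text \<open>Expand the vanishing bracket of \<open>x + y\<close> with itself. The sign is written as
  the scalar \<open>- 1\<close> to fit the calculus of combinations.\<close>

lemma (in lie_algebra) brk_swap:
  assumes x: "x \<in> carrier L" and y: "y \<in> carrier L"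
  shows "brk L y x = (- 1) \<odot>\<^bsub>L\<^esub> brk L x y"
proof -
  have "\<zero> = brk L (x \<oplus> y) (x \<oplus> y)"
    using assms by (simp add: brk_self)
  also have "\<dots> = (brk L x x \<oplus> brk L y x) \<oplus> (brk L x y \<oplus> brk L y y)"
    using assms by (simp add: brk_add_left brk_add_right)
  also have "\<dots> = brk L x y \<oplus> brk L y x"
    using assms by (simp add: brk_closed brk_self M.a_comm)
  finally have s: "brk L x y \<oplus> brk L y x = \<zero>" by simp
  have "brk L x y \<oplus> (- 1) \<odot>\<^bsub>L\<^esub> brk L x y = (1 + - 1) \<odot>\<^bsub>L\<^esub> brk L x y"
    using assms by (subst smult_add_left) (simp_all add: brk_closed)
  also have "\<dots> = \<zero>"
    using assms by (simp add: brk_closed)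
  finally have "(- 1) \<odot>\<^bsub>L\<^esub> brk L x y \<oplus> brk L x y = \<zero>" "brk L y x \<oplus> brk L x y = \<zero>"
    using s assms by (simp_all add: brk_closed M.a_comm)
  then have "\<ominus> brk L x y = (- 1) \<odot>\<^bsub>L\<^esub> brk L x y" "\<ominus> brk L x y = brk L y x"
    using assms by (auto intro!: M.minus_equality simp: brk_closed)
  then show ?thesis by simp
qed

text \<open>Here \<open>q\<close> stands for \<open>4 * (2 * p - 1)\<close>. The assumptions are
  symmetric in \<open>u\<close> and \<open>v\<close>, so each result about \<open>u\<close> can be
  instantiated for \<open>v\<close>.\<close>

locale lie_pair = lie_algebra L for L :: "('k::field, 'a, 'm) lie_alg_scheme" (structure) +
  fixes u v :: 'a and q :: 'k
  assumes u [simp]: "u \<in> carrier L" and v [simp]: "v \<in> carrier L"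
    and brk_uuv: "brk L u (brk L u v) = q \<odot>\<^bsub>L\<^esub> u \<oplus> 4 \<odot>\<^bsub>L\<^esub> v"
    and brk_vvu: "brk L v (brk L v u) = q \<odot>\<^bsub>L\<^esub> v \<oplus> 4 \<odot>\<^bsub>L\<^esub> u"
begin

abbreviation "w \<equiv> brk L u v"
abbreviation "comb \<equiv> comb3 u v w"

lemma w [simp]: "w \<in> carrier L"
  by (simp add: brk_closed)

lemmas comb_add = comb3_add[OF u v w]
lemmas comb_smult = comb3_smult[OF u v w]
lemmas comb_unit = comb3_unit[OF u v w]

lemma brk_generators:
  "brk L u w = comb q 4 0" "brk L v u = comb 0 0 (- 1)" "brk L v w = comb (- 4) (- q) 0"
  "brk L w u = comb (- q) (- 4) 0" "brk L w v = comb 4 q 0"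
proof -
  show uw: "brk L u w = comb q 4 0"
    by (simp add: brk_uuv comb3_def)
  show vu: "brk L v u = comb 0 0 (- 1)"
    using brk_swap[OF u v] by (simp add: comb3_def)
  \<comment> \<open>As \<open>[v, u] = - w\<close>, the second relation evaluates
    \<open>- [v, w]\<close>, that is \<open>[w, v]\<close>; the other order then follows by
    antisymmetry.\<close>
  have "comb 4 q 0 = brk L v (brk L v u)"
    by (simp add: brk_vvu comb3_def M.a_comm)
  also have "\<dots> = (- 1) \<odot>\<^bsub>L\<^esub> brk L v w"
    by (subst brk_swap[OF u v]) (simp add: brk_smult_right)
  also have "\<dots> = brk L w v"
    by (subst brk_swap[OF v w]) simp
  finally show wv: "brk L w v = comb 4 q 0" by simp
  show "brk L w u = comb (- q) (- 4) 0"
    using brk_swap[OF u w] by (simp add: uw comb_smult)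
  show "brk L v w = comb (- 4) (- q) 0"
    using brk_swap[OF w v] by (simp add: wv comb_smult)
qed

lemma brk_comb_right:
  assumes "x \<in> carrier L"
  shows "brk L x (comb a b c) = a \<odot>\<^bsub>L\<^esub> brk L x u \<oplus> b \<odot>\<^bsub>L\<^esub> brk L x v \<oplus> c \<odot>\<^bsub>L\<^esub> brk L x w"
  using assms by (simp add: comb3_def brk_add_right brk_smult_right)

lemma brk_comb_left:
  assumes "x \<in> carrier L"
  shows "brk L (comb a b c) x = a \<odot>\<^bsub>L\<^esub> brk L u x \<oplus> b \<odot>\<^bsub>L\<^esub> brk L v x \<oplus> c \<odot>\<^bsub>L\<^esub> brk L w x"
  using assms by (simp add: comb3_def brk_add_left brk_smult_left)

lemma zero_comb: "\<zero> = comb 0 0 0"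
  by (simp add: comb3_def)

text \<open>This and the next two lemmas describe the matrices of \<open>ad u\<close>,
  \<open>ad v\<close>, \<open>ad w\<close>. As identities between combinations they hold before
  independence of \<open>u, v, w\<close> is known.\<close>

lemma brk_u_comb: "brk L u (comb a b c) = comb (q * c) (4 * c) b"
proof -
  have "brk L u u = comb 0 0 0" "w = comb 0 0 1"
    by (simp_all add: brk_self zero_comb comb_unit)
  then have "brk L u (comb a b c)
      = a \<odot>\<^bsub>L\<^esub> comb 0 0 0 \<oplus> b \<odot>\<^bsub>L\<^esub> comb 0 0 1 \<oplus> c \<odot>\<^bsub>L\<^esub> comb q 4 0"
    by (simp only: brk_comb_right[OF u] brk_generators)
  then show ?thesis
    by (simp add: comb_smult comb_add mult.commute)
qed

lemma brk_v_comb: "brk L v (comb a b c) = comb (- 4 * c) (- q * c) (- a)"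
proof -
  have "brk L v v = comb 0 0 0"
    by (simp_all add: brk_self zero_comb)
  then have "brk L v (comb a b c)
      = a \<odot>\<^bsub>L\<^esub> comb 0 0 (- 1) \<oplus> b \<odot>\<^bsub>L\<^esub> comb 0 0 0 \<oplus> c \<odot>\<^bsub>L\<^esub> comb (- 4) (- q) 0"
    by (simp only: brk_comb_right[OF v] brk_generators)
  then show ?thesis
    by (simp add: comb_smult comb_add mult.commute)
qed

lemma brk_w_comb: "brk L w (comb a b c) = comb (4 * b - q * a) (q * b - 4 * a) 0"
proof -
  have "brk L w w = comb 0 0 0"
    by (simp_all add: brk_self zero_comb)
  then have "brk L w (comb a b c)
      = a \<odot>\<^bsub>L\<^esub> comb (- q) (- 4) 0 \<oplus> b \<odot>\<^bsub>L\<^esub> comb 4 q 0 \<oplus> c \<odot>\<^bsub>L\<^esub> comb 0 0 0"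
    by (simp only: brk_comb_right[OF w] brk_generators)
  then show ?thesis
    by (simp add: comb_smult comb_add mult.commute)
qed

text \<open>Closure of the span under the bracket, for the bracket case of the induction on
  terms.\<close>

lemma brk_comb: "\<exists>r s t. brk L (comb a b c) (comb a' b' c') = comb r s t"
  unfolding brk_comb_left[OF comb3_closed[OF u v w]] brk_u_comb brk_v_comb brk_w_comb
    comb_smult comb_add by blast

lemma swap: "lie_pair L v u q"
  by unfold_locales (simp_all add: brk_uuv brk_vvu)

text \<open>Since \<open>[v, u] = - w\<close>, exchanging the generators permutes the first two
  coefficients and negates the third. This carries a frame to the exchanged pair.\<close>

lemma comb_swap: "comb3 v u (brk L v u) a b c = comb b a (- c)"
proof -
  have "comb3 v u (brk L v u) a b c = a \<odot>\<^bsub>L\<^esub> comb 0 1 0 \<oplus> b \<odot>\<^bsub>L\<^esub> comb 1 0 0 \<oplus> c \<odot>\<^bsub>L\<^esub> comb 0 0 (- 1)"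
    unfolding comb3_def[of v u] by (simp only: brk_generators comb_unit)
  then show ?thesis
    by (simp add: comb_smult comb_add)
qed

lemma frame3_swap:
  assumes F: "frame3 u v w"
  shows "frame3 v u (brk L v u)"
  unfolding frame3_def comb_swap
proof (intro conjI ballI allI impI)
  show "{v, u, brk L v u} \<subseteq> carrier L"
    by (simp add: brk_closed)
  show "\<exists>a b c. x = comb b a (- c)" if "x \<in> carrier L" for x
  proof -
    obtain a b c where "x = comb a b c"
      using F \<open>x \<in> carrier L\<close> unfolding frame3_def by blast
    then have "x = comb a b (- (- c))"
      by simp
    then show ?thesis
      by blast
  qed
  fix a b c a' b' c'
  assume "comb b a (- c) = comb b' a' (- c')"
  then have "b = b' \<and> a = a' \<and> - c = - c'"
    using F unfolding frame3_def by blast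
  then show "a = a'" "b = b'" "c = c'"
    by auto
qed

section \<open>The Killing form and semisimplicity\<close>

lemma lie_form_u_u:
  assumes F: "frame3 u v w" and "(2::'k) \<noteq> 0"
  shows "lie_form L u u = 1"
proof -
  \<comment> \<open>The square of \<open>ad u\<close> has diagonal \<open>0, 4, 4\<close> in the
    frame, so its trace is 8 and cancels the normalizing factor.\<close>
  have "killing_form L u u = 0 + 4 + 4"
    unfolding killing_form_def
  proof (rule op_trace_frame3[OF F ad_comp_hom[OF u u]])
    show "(ad L u \<circ> ad L u) u = comb 0 0 0"
      using brk_u_comb[of 1 0 0] brk_u_comb[of 0 0 0] by (simp add: ad_def comb_unit)
    show "(ad L u \<circ> ad L u) v = comb q 4 0"
      using brk_u_comb[of 0 1 0] brk_u_comb[of 0 0 1] by (simp add: ad_def comb_unit)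
    show "(ad L u \<circ> ad L u) w = comb 0 0 4"
      using brk_u_comb[of 0 0 1] brk_u_comb[of q 4 0] by (simp add: ad_def comb_unit)
  qed
  then show ?thesis
    using four_eight_nonzero[OF assms(2)] by (simp add: lie_form_def)
qed

lemma lie_form_u_v:
  assumes F: "frame3 u v w" and "(2::'k) \<noteq> 0"
  shows "lie_form L u v = - q / 4"
proof -
  \<comment> \<open>The diagonal of \<open>ad u \<circ> ad v\<close> is
    \<open>- q, 0, - q\<close>.\<close>
  have "killing_form L u v = - q + 0 + - q"
    unfolding killing_form_def
  proof (rule op_trace_frame3[OF F ad_comp_hom[OF u v]])
    show "(ad L u \<circ> ad L v) u = comb (- q) (- 4) 0"
      using brk_v_comb[of 1 0 0] brk_u_comb[of 0 0 "- 1"] by (simp add: ad_def comb_unit)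
    show "(ad L u \<circ> ad L v) v = comb 0 0 0"
      using brk_v_comb[of 0 1 0] brk_u_comb[of 0 0 0] by (simp add: ad_def comb_unit)
    show "(ad L u \<circ> ad L v) w = comb 0 0 (- q)"
      using brk_v_comb[of 0 0 1] brk_u_comb[of "- 4" "- q" 0] by (simp add: ad_def comb_unit)
  qed
  then show ?thesis
    using four_eight_nonzero[OF assms(2)] by (simp add: lie_form_def field_simps)
qed

text \<open>The eigenvalues of \<open>ad u\<close> are \<open>0\<close>, \<open>2\<close> and \<open>-2\<close>; multiplying the eigenvectors by \<open>2\<close>
  keeps the coefficient \<open>q\<close> of \<open>u\<close> free of denominators.\<close>

lemma semisimple_u:
  assumes F: "frame3 u v w" and two: "(2::'k) \<noteq> 0"
  shows "semisimple_elt L u"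
proof -
  define x where "x = comb q 4 2"
  define y where "y = comb (- q) (- 4) 2"
  have x: "x \<in> carrier L" and y: "y \<in> carrier L"
    by (simp_all add: x_def y_def)
  note four = four_eight_nonzero(1)[OF two]
  have inj: "\<And>a b c a' b' c'. comb a b c = comb a' b' c' \<Longrightarrow> a = a' \<and> b = b' \<and> c = c'"
    and sur: "\<And>z. z \<in> carrier L \<Longrightarrow> \<exists>a b c. z = comb a b c"
    using F unfolding frame3_def by blast+
  have comb': "comb3 u x y a b c = comb (a + q * b - q * c) (4 * b - 4 * c) (2 * b + 2 * c)" for a b c
  proof -
    have "comb3 u x y a b c = a \<odot>\<^bsub>L\<^esub> comb 1 0 0 \<oplus> b \<odot>\<^bsub>L\<^esub> x \<oplus> c \<odot>\<^bsub>L\<^esub> y"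
      unfolding comb3_def[of u x] by (simp only: comb_unit)
    then show ?thesis
      by (simp add: x_def y_def comb_smult comb_add mult.commute)
  qed
  have "frame3 u x y"
    unfolding frame3_def
  proof (intro conjI ballI allI impI)
    show "{u, x, y} \<subseteq> carrier L"
      using x y by simp
    show "\<exists>a b c. z = comb3 u x y a b c" if z: "z \<in> carrier L" for z
    proof -
      obtain a b c where abc: "z = comb a b c"
        using sur[OF z] by blast
      \<comment> \<open>The coefficients \<open>r\<close>, \<open>s\<close> of \<open>x\<close>,
        \<open>y\<close> solve \<open>4 * (r - s) = b\<close> and \<open>2 * (r + s) = c\<close>,
        hence the eighths; the coefficient of \<open>u\<close> compensates for
        \<open>q * (r - s)\<close>.\<close>
      have d: "4 * (t / 8) = t / 2" "2 * (t / 8) = t / 4" for t :: 'k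
        using two four_eight_nonzero[OF two] by (simp_all add: field_simps)
      have h: "4 * ((2 * c + b) / 8) - 4 * ((2 * c - b) / 8) = b"
          "2 * ((2 * c + b) / 8) + 2 * ((2 * c - b) / 8) = c"
        unfolding d diff_divide_distrib[symmetric] add_divide_distrib[symmetric]
        using two four by simp_all
      have "z = comb3 u x y (a - q * ((2 * c + b) / 8) + q * ((2 * c - b) / 8))
          ((2 * c + b) / 8) ((2 * c - b) / 8)"
        unfolding comb' h abc by simp
      then show ?thesis by blast
    qed
    fix a b c a' b' c'
    assume "comb3 u x y a b c = comb3 u x y a' b' c'"
    then have e: "a + q * b - q * c = a' + q * b' - q * c'" "4 * b - 4 * c = 4 * b' - 4 * c'"
        "2 * b + 2 * c = 2 * b' + 2 * c'"
      unfolding comb' by (auto dest!: inj)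
    \<comment> \<open>Half of the second equation plus the third eliminates \<open>c\<close> and
      \<open>c'\<close>.\<close>
    have "4 * (b - b') = (4 * b - 4 * c - (4 * b' - 4 * c')) / 2 + (2 * b + 2 * c - (2 * b' + 2 * c'))"
      using two by (simp add: field_simps)
    then have "4 * (b - b') = 0"
      using e by simp
    then show b: "b = b'"
      using four by simp
    then show c: "c = c'"
      using e two by simp
    show "a = a'"
      using e b c by simp
  qed
  moreover have "ad L u u = 0 \<odot>\<^bsub>L\<^esub> u" "ad L u x = 2 \<odot>\<^bsub>L\<^esub> x" "ad L u y = (- 2) \<odot>\<^bsub>L\<^esub> y"
    by (simp_all add: ad_def brk_self x_def y_def brk_u_comb comb_smult mult.commute)
  ultimately have "basis {u, x, y}" "\<forall>b\<in>{u, x, y}. \<exists>c. ad L u b = c \<odot>\<^bsub>L\<^esub> b"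
    by (blast intro: frame3_basis)+
  then show ?thesis
    unfolding semisimple_elt_def diagonalizable_op_def using u by blast
qed

lemma normalized_semisimple_u:
  assumes "frame3 u v w" "(2::'k) \<noteq> 0"
  shows "normalized_semisimple L u"
  using semisimple_u[OF assms] lie_form_u_u[OF assms] by (simp add: normalized_semisimple_def)

end

section \<open>A spanning set of the presented algebra\<close>

lemma lie_pair_uv: "lie_pair (uv_lie p) (uv_u p) (uv_v p) (4 * (2 * p - 1))"
proof -
  interpret lie_algebra "uv_lie p"
    unfolding uv_lie_def by (rule lie_algebra_presented)
  show ?thesis
    by unfold_locales
      (auto simp: uv_lie_def uv_u_def uv_v_def lie_presented_simps lie_class_eq_iff uv_rels_def
        Let_def rangeI intro: lie_eq.rel)
qed

text \<open>Every element is the class of a term, and induction on terms keeps within combinations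
  of \<open>u, v, w\<close>. This bounds the dimension by three; the homomorphism to
  \<open>sl 2\<close> supplies independence.\<close>

lemma uv_lie_span:
  assumes "x \<in> carrier (uv_lie p)"
  shows "\<exists>a b c. x = type_vectorspace.comb3 (uv_lie p) (uv_u p) (uv_v p)
    (brk (uv_lie p) (uv_u p) (uv_v p)) a b c"
proof -
  interpret lie_pair "uv_lie p" "uv_u p" "uv_v p" "4 * (2 * p - 1)"
    by (rule lie_pair_uv)
  have "\<exists>a b c. lie_class (uv_rels p) t = comb a b c" for t
  proof (induction t)
    case (Gen g)
    show ?case
      using comb_unit by (cases g) (metis uv_u_def uv_v_def)+
  next
    case Zero
    show ?case
      using zero_comb by (auto simp: uv_lie_def lie_presented_simps)
  next
    case (Add s t)
    then show ?case
      using comb_add lie_presented_simps(3)[of "uv_rels p" s t] by (metis uv_lie_def)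
  next
    case (Smult k s)
    then show ?case
      using comb_smult lie_presented_simps(4)[where c = k and R = "uv_rels p" and s = s] by (metis uv_lie_def)
  next
    case (Brk s t)
    then show ?case
      using brk_comb lie_presented_simps(5)[of "uv_rels p" s t] by (metis uv_lie_def)
  qed
  then show ?thesis
    using assms by (auto simp: uv_lie_def lie_presented_simps)
qed

section \<open>Traceless matrices in coordinates and the homomorphism onto them\<close>

text \<open>The matrix with rows \<open>(x, y)\<close> and \<open>(z, - x)\<close>: trace zero is
  built in and \<open>sl 2\<close> becomes a space of triples.\<close>

definition sl2_mat :: "'k::field \<Rightarrow> 'k \<Rightarrow> 'k \<Rightarrow> 'k mat" where
  "sl2_mat x y z = mat 2 2 (\<lambda>(i, j). if i = 0 then (if j = 0 then x else y) else (if j = 0 then z else - x))"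

lemma carrier_sl2: "carrier (sl 2) = {sl2_mat x y z | x y z. True}"
proof (intro equalityI subsetI)
  fix A :: "'a mat" assume "A \<in> carrier (sl 2)"
  then have A: "A \<in> carrier_mat 2 2" "A $$ (0, 0) + A $$ (1, 1) = 0"
    by (auto simp: sl_def mat_trace_def numeral_2_eq_2)
  then have "A = sl2_mat (A $$ (0, 0)) (A $$ (0, 1)) (A $$ (1, 0))"
    by (intro eq_matI) (auto simp: sl2_mat_def less_2_cases_iff minus_unique)
  then show "A \<in> {sl2_mat x y z | x y z. True}" by blast
qed (auto simp: sl_def sl2_mat_def mat_trace_def numeral_2_eq_2)

lemma sl2_mat_closed: "sl2_mat x y z \<in> carrier (sl 2)"
  by (auto simp: carrier_sl2)

lemma sl2_mat_inject: "sl2_mat x y z = sl2_mat x' y' z' \<longleftrightarrow> x = x' \<and> y = y' \<and> z = z'"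
proof
  assume e: "sl2_mat x y z = sl2_mat x' y' z'"
  have "sl2_mat x y z $$ (0, 0) = x" "sl2_mat x y z $$ (0, 1) = y" "sl2_mat x y z $$ (1, 0) = z" for x y z :: 'a
    by (simp_all add: sl2_mat_def)
  with e show "x = x' \<and> y = y' \<and> z = z'" by metis
qed simp

lemma sl2_simps:
  "sl2_mat x y z \<oplus>\<^bsub>sl 2\<^esub> sl2_mat x' y' z' = sl2_mat (x + x') (y + y') (z + z')"
  "c \<odot>\<^bsub>sl 2\<^esub> sl2_mat x y z = sl2_mat (c * x) (c * y) (c * z)"
  "brk (sl 2) (sl2_mat x y z) (sl2_mat x' y' z') =
    sl2_mat (y * z' - y' * z) (2 * (x * y' - x' * y)) (2 * (z * x' - z' * x))"
  by (auto simp: sl_def sl2_mat_def scalar_prod_def less_2_cases_iff numeral_2_eq_2 algebra_simps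
      intro!: eq_matI)

text \<open>The pair \<open>diag(1, -1)\<close>, \<open>(1 - 2p, 2p; 2(1 - p), 2p - 1)\<close> of traceless involutions
  satisfies the defining relations.\<close>

lemma uv_lie_to_sl2:
  "\<exists>h \<in> lie_hom (uv_lie p) (sl 2). h (uv_u p) = sl2_mat 1 0 0 \<and>
    h (uv_v p) = sl2_mat (1 - 2 * p) (2 * p) (2 * (1 - p))"
proof -
  interpret S: lie_algebra "sl 2 :: ('a, 'a mat) lie_alg"
    by (rule lie_algebra_sl)
  define f where "f = case_gens (sl2_mat 1 0 0) (sl2_mat (1 - 2 * p) (2 * p) (2 * (1 - p)))"
  have "range f \<subseteq> carrier (sl 2)"
    by (auto simp: f_def sl2_mat_closed split: gens.splits)
  moreover have "lie_eval (sl 2) f s = lie_eval (sl 2) f t" if "(s, t) \<in> uv_rels p" for s t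
    using that by (auto simp: uv_rels_def Let_def f_def sl2_simps sl2_mat_inject algebra_simps)
  ultimately obtain h where "h \<in> lie_hom (lie_presented (uv_rels p)) (sl 2)"
    and "\<And>g. h (lie_class (uv_rels p) (Gen g)) = f g"
    using S.lie_presented_universal[of f "uv_rels p"] by blast
  then show ?thesis
    by (intro bexI[of _ h]) (simp_all add: uv_lie_def uv_u_def uv_v_def f_def)
qed

text \<open>Both claims come from one computation: the matrix \<open>h (comb a b c)\<close>
  determines \<open>a, b, c\<close>. Hence the spanning triple is a frame and \<open>h\<close> is
  injective; solving for the coefficients gives surjectivity.\<close>

lemma uv_lie_sl2:
  fixes p :: "'k::field"
  assumes two: "(2::'k) \<noteq> 0" and p: "p \<noteq> 0" "p \<noteq> 1"
  shows "lie_isomorphic (uv_lie p) (sl 2 :: ('k, 'k mat) lie_alg)"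
    and "type_vectorspace.frame3 (uv_lie p) (uv_u p) (uv_v p) (brk (uv_lie p) (uv_u p) (uv_v p))"
proof -
  interpret lie_pair "uv_lie p" "uv_u p" "uv_v p" "4 * (2 * p - 1)"
    by (rule lie_pair_uv)
  obtain h where h: "h \<in> lie_hom (uv_lie p) (sl 2)"
    and hu: "h (uv_u p) = sl2_mat 1 0 0"
    and hv: "h (uv_v p) = sl2_mat (1 - 2 * p) (2 * p) (2 * (1 - p))"
    using uv_lie_to_sl2 by blast
  have h_brk: "h (brk (uv_lie p) x y) = brk (sl 2) (h x) (h y)"
    and h_add: "h (x \<oplus>\<^bsub>uv_lie p\<^esub> y) = h x \<oplus>\<^bsub>sl 2\<^esub> h y"
    if "x \<in> carrier (uv_lie p)" "y \<in> carrier (uv_lie p)" for x y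
    using h that by (auto simp: lie_hom_def LinearCombinations.module_hom_def)
  have h_smult: "h (c \<odot>\<^bsub>uv_lie p\<^esub> x) = c \<odot>\<^bsub>sl 2\<^esub> h x"
    and h_closed: "h x \<in> carrier (sl 2)"
    if "x \<in> carrier (uv_lie p)" for x c
    using h that by (auto simp: lie_hom_def LinearCombinations.module_hom_def)
  have h_w: "h w = sl2_mat 0 (4 * p) (4 * (p - 1))"
    by (simp add: h_brk hu hv sl2_simps sl2_mat_inject algebra_simps)
  have h_comb: "h (comb a b c) = sl2_mat (a + b * (1 - 2 * p)) (2 * p * (b + 2 * c)) (2 * (1 - p) * (b - 2 * c))" for a b c
    unfolding comb3_def
    by (simp add: h_add h_smult hu hv h_w sl2_simps sl2_mat_inject algebra_simps)
  \<comment> \<open>These are the factors of the off-diagonal entries in \<open>h_comb\<close>;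
    cancelling them is where \<open>p \<noteq> 0\<close> and \<open>p \<noteq> 1\<close>
    enter.\<close>
  have nz: "2 * p \<noteq> 0" "2 * (1 - p) \<noteq> 0"
    using two p by auto
  have inj: "a = a' \<and> b = b' \<and> c = c'" if e: "h (comb a b c) = h (comb a' b' c')" for a b c a' b' c'
  proof -
    have e1: "a + b * (1 - 2 * p) = a' + b' * (1 - 2 * p)"
      and e2: "b + 2 * c = b' + 2 * c'" and e3: "b - 2 * c = b' - 2 * c'"
      using e nz unfolding h_comb sl2_mat_inject by (auto simp only: mult_cancel_left)
    \<comment> \<open>Sum and difference of \<open>b + 2 * c\<close> and \<open>b - 2 * c\<close>
      isolate \<open>b\<close> and \<open>c\<close> up to powers of 2.\<close>
    have "2 * b = (b + 2 * c) + (b - 2 * c)" "2 * b' = (b' + 2 * c') + (b' - 2 * c')"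
      "2 * (2 * c) = (b + 2 * c) - (b - 2 * c)" "2 * (2 * c') = (b' + 2 * c') - (b' - 2 * c')"
      by simp_all
    then have "2 * b = 2 * b'" "2 * (2 * c) = 2 * (2 * c')"
      using e2 e3 by metis+
    then have "b = b'" "c = c'"
      using two by (simp_all only: mult_cancel_left simp_thms)
    then show ?thesis
      using e1 by simp
  qed
  show "frame3 (uv_u p) (uv_v p) w"
    unfolding frame3_def
  proof (intro conjI ballI)
    show "\<exists>a b c. x = comb a b c" if "x \<in> carrier (uv_lie p)" for x
      using uv_lie_span that by blast
    show "\<forall>a b c a' b' c'. comb a b c = comb a' b' c' \<longrightarrow> a = a' \<and> b = b' \<and> c = c'"
      by (intro allI impI inj) simp
  qed simp
  have "bij_betw h (carrier (uv_lie p)) (carrier (sl 2))"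
  proof (rule bij_betwI')
    fix x y assume "x \<in> carrier (uv_lie p)" "y \<in> carrier (uv_lie p)"
    then obtain a b c a' b' c' where "x = comb a b c" "y = comb a' b' c'"
      using uv_lie_span by meson
    then show "(h x = h y) = (x = y)"
      using inj by blast
  next
    fix x assume "x \<in> carrier (uv_lie p)"
    then show "h x \<in> carrier (sl 2)"
      using h_closed by blast
  next
    fix A :: "'k mat" assume "A \<in> carrier (sl 2)"
    then obtain x y z where A: "A = sl2_mat x y z"
      by (auto simp: carrier_sl2)
    \<comment> \<open>The preimage must satisfy \<open>b + 2 * c = s\<close> and
      \<open>b - 2 * c = t\<close>; these give \<open>b\<close> and \<open>c\<close>, and the
      diagonal entry then gives the coefficient of \<open>u\<close>.\<close>
    define s where "s = y / (2 * p)"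
    define t where "t = z / (2 * (1 - p))"
    have y: "y = 2 * p * s" and z: "z = 2 * (1 - p) * t"
      using nz by (simp_all only: s_def t_def) (simp_all add: field_simps)
    define b where "b = (s + t) / 2"
    define c where "c = (s - t) / 4"
    have "b + 2 * c = s" "b - 2 * c = t"
      unfolding b_def c_def using two four_eight_nonzero[OF two] by (simp_all add: field_simps)
    then have "h (comb (x - b * (1 - 2 * p)) b c) = A"
      unfolding h_comb A y z by simp
    then show "\<exists>x \<in> carrier (uv_lie p). A = h x"
      by (intro bexI[of _ "comb (x - b * (1 - 2 * p)) b c"]) auto
  qed
  then show "lie_isomorphic (uv_lie p) (sl 2 :: ('k, 'k mat) lie_alg)"
    using h by (auto simp: lie_isomorphic_def lie_iso_def)
qed

theorem lemma2p13:
  fixes p :: "'k::alg_closed_field"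
  assumes "CHAR('k) \<noteq> 2" and "p \<noteq> 0" and "p \<noteq> 1"
  shows "lie_isomorphic (uv_lie p) (sl 2 :: ('k, 'k mat) lie_alg) \<and>
    normalized_semisimple (uv_lie p) (uv_u p) \<and>
    normalized_semisimple (uv_lie p) (uv_v p) \<and>
    corresponding_parameter (uv_lie p) (uv_u p) (uv_v p) p"
proof -
  have two: "(2::'k) \<noteq> 0"
  proof
    assume "(2::'k) = 0"
    then have "of_nat 2 = (0::'k)" by simp
    \<comment> \<open>A divisor of the prime 2 is 1 or 2, and a field cannot have characteristic
      1.\<close>
    then have "CHAR('k) dvd 2"
      by (simp only: of_nat_eq_0_iff_char_dvd)
    then have "CHAR('k) = 1 \<or> CHAR('k) = 2"
      by (metis two_is_prime_nat prime_nat_iff)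
    with assms(1) show False
      by (simp add: CHAR_not_1')
  qed
  interpret lie_pair "uv_lie p" "uv_u p" "uv_v p" "4 * (2 * p - 1)"
    by (rule lie_pair_uv)
  interpret vu: lie_pair "uv_lie p" "uv_v p" "uv_u p" "4 * (2 * p - 1)"
    by (rule swap)
  note F = uv_lie_sl2(2)[OF two assms(2,3)]
  note four = four_eight_nonzero(1)[OF two]
  \<comment> \<open>With \<open>q = 4 * (2 * p - 1)\<close> the value \<open>- q / 4\<close> is
    \<open>1 - 2 * p\<close>.\<close>
  have "lie_form (uv_lie p) (uv_u p) (uv_v p) = 1 - 2 * p"
    using lie_form_u_v[OF F two] nonzero_mult_div_cancel_left[OF four, of "2 * p - 1"]
    by (simp only: minus_divide_left[symmetric]) simp
  then show ?thesis
    using uv_lie_sl2(1)[OF two assms(2,3)] normalized_semisimple_u[OF F two]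
      vu.normalized_semisimple_u[OF frame3_swap[OF F] two]
    by (simp add: corresponding_parameter_def)
qed

end
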